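(* Let $\mathcal{T}$ be a mesh of $\Omega\subset\mathbb{R}^d$ with vertex set $S$ and let $\mathcal{D}$ be a sizing function with discrepancies $\zeta_K$, all as described in the context. Let $v$ be a function on $\Omega$ that is piecewise $H^1$ with respect to $\mathcal{T}$ and whose gradient on each $K\in\mathcal{T}$ is continuous on the closed simplex $K$. Let $(\nabla v)_h$ be the piecewise polynomial interpolation of $\nabla v$ of degree $\le k$, let $(\nabla v)^{\ast}$ be a piecewise polynomial best approximation of $\nabla v$ of degree $\le k$ over $\mathcal{T}$, and let $\Lambda$ be the Lebesgue constant of the interpolation points. Then $$\big\|\nabla v-(\nabla v)_h\big\|_{L_2(\Omega)}\;\le\;\frac{(1+\Lambda)\,C_3\,\sqrt{\Theta}}{C_1}\;\big\|\nabla v-(\nabla v)^{\ast}\big\|_{L_\infty(\Omega)},$$ where $$C_1=\sqrt{\frac{d+1}{2d}}\,\min_{K}\left(\frac{\min_{1\le s\le d+1}\mathrm{dist}\left(\bm{p}_{K,s},\mathrm{aff}(\mathcal{F}_{K,s})\right)}{\Delta(K)}\right),$$ $$C_3=\sqrt{\min\left[\frac12\max_{K}\left(R_{K,\min}\right)^2\left\|\frac{1}{\mathcal{D}^2}\right\|_{2,L_\infty(\Omega)}+\left\|\frac{1}{\mathcal{D}^2}\right\|_{L_\infty(\Omega)}+\max_K|\zeta_K|,\ \frac{1}{\eta^2}\right]},\qquad \Theta=\sum_{K\in\mathcal{T}}\left(\sum_{i=1}^{d+1}\sum_{j=1}^{i-1}(\bm{p}_{K,ij}\cdot\bm{p}_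{K,ij})\,|K|\right).$$
   Context: Points and mesh. $d\ge 1$ is an integer. $S=\{\bm{p}_1,\dots,\bm{p}_{N_v}\}\subset\mathbb{R}^d$ is a finite point set and $\Omega=\mathrm{conv}(S)$ (a bounded $d$-dimensional polytope). $S$ is an $(\varepsilon,\overline{\eta})$-net with $\varepsilon,\eta>0$, $\overline{\eta}=\eta/\varepsilon$: every $\bm{x}\in\Omega$ has some $\bm{p}_l\in S$ with $|\bm{x}-\bm{p}_l|\le\varepsilon$, and $|\bm{p}_l-\bm{p}_n|\ge\eta$ for all distinct $\bm{p}_l,\bm{p}_n\in S$. $\mathcal{T}$ is a triangulation of $\Omega$ whose vertices are the points of $S$: a finite set of non-overlapping (nondegenerate) $d$-simplices $K$ whose total hypervolume is that of $\Omega$, forming a pure simplicial $d$-complex, without hanging nodes, that is $d$-connected and in which each $(d-1)$-simplex (facet) has exactly one (boundary) or two (interior) $d$-simplex neighbors. The vertices of $K$ are $\bm{p}_{K,1},\dots,\bm{p}_{K,d+1}$, and $\bm{p}_{K,ij}=\bm{p}_{K,j}-\bm{p}_{K,i}$. $\mathcal{F}_{K,s}$ is the facet of $K$ opposite to $\bm{p}_{K,s}$, $\mathrm{aff}$ denotes affine hull and $\mathrm{dist}$ Euclidean distance. $|K|$ is the $d$-dimensional volume of $K$, $\Delta(K)$ its diameter (longest edge length), and $R_{K,\min}$ its min-containment radius (radius of the smallest ball containing $K$). $\min_K,\max_K$ are over $K\in\mathcal{T}$. Sizing function. $\mathcal{D}:\Omega\to(0,\infty)$ satisfies $1/\mathcal{D}^2\in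 C^2(\Omega)$. For each $K$, $\zeta_K\in\mathbb{R}$ is chosen so that $$\min_{1\le i\le d+1}\frac{1}{\mathcal{D}^2(\bm{p}_{K,i})}\le\frac{1}{\Delta(K)^2}+\zeta_K\le\max_{1\le i\le d+1}\frac{1}{\mathcal{D}^2(\bm{p}_{K,i})}.$$ For a $C^2$ function $g$, $\|g\|_{2,L_\infty(\Omega)}$ is the $L_\infty(\Omega)$ norm of $\bm{x}\mapsto\sup_{|\bm{u}_1|\le1,|\bm{u}_2|\le1}\left|\frac{\partial}{\partial\bm{u}_1}\frac{\partial}{\partial\bm{u}_2}g(\bm{x})\right|$, with $\partial/\partial\bm{u}$ the directional derivative. Norms. Piecewise $H^1$ means $v|_K\in H^1(K)$ for every $K\in\mathcal{T}$; $\nabla v$ is the elementwise gradient. For a vector field $\bm{g}:\Omega\to\mathbb{R}^d$, $\|\bm{g}\|_{L_2(\Omega)}=\left[\sum_{K\in\mathcal{T}}\int_K\bm{g}\cdot\bm{g}\,dV\right]^{1/2}$ and $\|\bm{g}\|_{L_\infty(\Omega)}$ is the essential supremum of the Euclidean norm $|\bm{g}(\bm{x})|$ over $\Omega$. Interpolation. Fix a degree $k\ge0$, $N_p=\frac{(k+d)!}{k!\,d!}$, a reference $d$-simplex, and interpolation points $\bm{\xi}_1,\dots,\bm{\xi}_{N_p}$ in it that are unisolvent for polynomials of degree $\le k$; $L_1,\dots,L_{N_p}$ are the corresponding Lagrange polynomials of degree $\le k$, $L_j(\bm{\xi}_m)=1$ if $j=m$ and $0$ otherwise. For each $K$, $\bm{x}\mapsto\bm{\xi}(\bm{x})$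 is the affine bijection from $K$ to the reference simplex, and $\bm{x}_j\in K$ is the preimage of $\bm{\xi}_j$. On $K$, $(\nabla v)_h$ has components $\left(\frac{\partial v}{\partial x_i}\right)_h(\bm{x})=\sum_{j=1}^{N_p}\frac{\partial v}{\partial x_i}(\bm{x}_j)L_j(\bm{\xi}(\bm{x}))$, $i=1,\dots,d$, where point values are those of the continuous gradient on the closed simplex $K$. The Lebesgue constant is $\Lambda=\max_{\bm{\xi}}\sum_{m=1}^{N_p}|L_m(\bm{\xi})|$, maximum over the reference simplex. The best approximation $(\nabla v)^{\ast}$ is defined componentwise and elementwise: on each $K$, its $i$-th component $\left(\frac{\partial v}{\partial x_i}\right)^{\ast}$ is a polynomial of degree $\le k$ minimizing $\left\|\frac{\partial v}{\partial x_i}-q\right\|_{L_\infty(K)}$ over all polynomials $q$ of degree $\le k$. *)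

theory Defs
  imports "HOL-Analysis.Analysis" "HOL-Probability.Essential_Supremum"
begin

section \<open>Meshes\<close>

definition is_net :: "(real ^ 'n) set \<Rightarrow> real \<Rightarrow> real \<Rightarrow> bool" where
  "is_net S \<epsilon> \<eta> \<longleftrightarrow>
     (\<forall>x \<in> convex hull S. \<exists>p\<in>S. dist x p \<le> \<epsilon>) \<and>
     (\<forall>p\<in>S. \<forall>q\<in>S. p \<noteq> q \<longrightarrow> \<eta> \<le> dist p q)"

definition verts :: "(real ^ 'n) set \<Rightarrow> (real ^ 'n) set" where
  "verts K = {x. x extreme_point_of K}"

definition facet_adjacent :: "(real ^ 'n) set set \<Rightarrow> ((real ^ 'n) set \<times> (real ^ 'n) set) set" where
  "facet_adjacent \<T> =
     {(K, K'). K \<in> \<T> \<and> K' \<in> \<T> \<and> (\<exists>F. F facet_of K \<and> F facet_of K')}"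

text \<open>
  A mesh is given by its top-dimensional simplices. The simplicial complex consists of
  all their faces; it is pure because every member is a face of a \<open>d\<close>-simplex, where
  \<open>d = CARD('n)\<close>. Being \<open>d\<close>-connected means that any two \<open>d\<close>-simplices are joined by a chain of
  \<open>d\<close>-simplices of the mesh in which consecutive ones share a \<open>(d-1)\<close>-face.
\<close>

definition is_mesh :: "(real ^ 'n) set \<Rightarrow> (real ^ 'n) set set \<Rightarrow> bool" where
  "is_mesh S \<T> \<longleftrightarrow>
     finite \<T> \<and>
     (\<forall>K\<in>\<T>. int CARD('n) simplex K) \<and>
     (\<Union>K\<in>\<T>. verts K) = S \<and>
     (\<forall>K\<in>\<T>. \<forall>K'\<in>\<T>. K \<noteq> K' \<longrightarrow> interior K \<inter> interior K' = {}) \<and>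
     (\<Sum>K\<in>\<T>. measure lebesgue K) = measure lebesgue (convex hull S) \<and>
     simplicial_complex {F. \<exists>K\<in>\<T>. F face_of K} \<and>
     (\<forall>K\<in>\<T>. S \<inter> K \<subseteq> verts K) \<and>
     (\<forall>K\<in>\<T>. \<forall>K'\<in>\<T>. (K, K') \<in> (facet_adjacent \<T>)\<^sup>*) \<and>
     (\<forall>F. (\<exists>K\<in>\<T>. F facet_of K) \<longrightarrow>
        card {K\<in>\<T>. F facet_of K} = (if F \<subseteq> frontier (convex hull S) then 1 else 2))"

text \<open>The vertices of each simplex are numbered \<open>1, \<dots>, d + 1\<close> by \<open>p K\<close>.\<close>

definition opposite_facet ::
  "((real ^ 'n) set \<Rightarrow> nat \<Rightarrow> real ^ 'n) \<Rightarrow> (real ^ 'n) set \<Rightarrow> nat \<Rightarrow> (real ^ 'n) set" where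
  "opposite_facet p K s = convex hull (p K ` ({1..CARD('n) + 1} - {s}))"

definition min_containment_radius :: "(real ^ 'n) set \<Rightarrow> real" where
  "min_containment_radius K = Inf {r. \<exists>c. K \<subseteq> cball c r}"


section \<open>Differentiability on closed sets and norms\<close>

text \<open>
  Derivatives are taken within the set. On a convex set with nonempty interior they are
  unique, also at boundary points, so \<open>Ck_on n A f\<close> says that the derivatives of \<open>f\<close> up to
  order \<open>n\<close> exist and are continuous up to the boundary.
\<close>

definition dir_deriv :: "(real ^ 'n) set \<Rightarrow> real ^ 'n \<Rightarrow> (real ^ 'n \<Rightarrow> real) \<Rightarrow> real ^ 'n \<Rightarrow> real" where
  "dir_deriv A u f x = frechet_derivative f (at x within A) u"

primrec Ck_on :: "nat \<Rightarrow> (real ^ 'n) set \<Rightarrow> (real ^ 'n \<Rightarrow> real) \<Rightarrow> bool" where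
  "Ck_on 0 A f \<longleftrightarrow> continuous_on A f"
| "Ck_on (Suc n) A f \<longleftrightarrow>
     (\<forall>x\<in>A. f differentiable (at x within A)) \<and> (\<forall>u. Ck_on n A (dir_deriv A u f))"

text \<open>
  The conversion to \<open>real\<close> is harmless for essentially bounded measurable functions;
  otherwise \<open>esssup\<close> may be \<open>\<infinity>\<close> and \<open>Linf_norm\<close> is \<open>0\<close>.
\<close>

definition Linf_norm :: "(real ^ 'n) set \<Rightarrow> (real ^ 'n \<Rightarrow> 'b::real_normed_vector) \<Rightarrow> real" where
  "Linf_norm A g = real_of_ereal (esssup (lebesgue_on A) (\<lambda>x. ereal (norm (g x))))"

definition C2_seminorm :: "(real ^ 'n) set \<Rightarrow> (real ^ 'n \<Rightarrow> real) \<Rightarrow> real" where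
  "C2_seminorm A g =
     Linf_norm A (\<lambda>x. SUP (u1, u2) \<in> cball 0 1 \<times> cball 0 1. \<bar>dir_deriv A u1 (dir_deriv A u2 g) x\<bar>)"

definition L2_norm_mesh :: "(real ^ 'n) set set \<Rightarrow> (real ^ 'n \<Rightarrow> real ^ 'n) \<Rightarrow> real" where
  "L2_norm_mesh \<T> g = sqrt (\<Sum>K\<in>\<T>. LINT x:K|lebesgue. g x \<bullet> g x)"


section \<open>Piecewise Sobolev functions\<close>

definition L2_on :: "(real ^ 'n) set \<Rightarrow> (real ^ 'n \<Rightarrow> real) \<Rightarrow> bool" where
  "L2_on A f \<longleftrightarrow> f \<in> borel_measurable (lebesgue_on A) \<and> integrable (lebesgue_on A) (\<lambda>x. (f x)\<^sup>2)"

definition test_function :: "(real ^ 'n) set \<Rightarrow> (real ^ 'n \<Rightarrow> real) \<Rightarrow> bool" where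
  "test_function U \<phi> \<longleftrightarrow>
     (\<forall>n. Ck_on n UNIV \<phi>) \<and> compact (closure {x. \<phi> x \<noteq> 0}) \<and> closure {x. \<phi> x \<noteq> 0} \<subseteq> U"

definition weak_gradient_on ::
  "(real ^ 'n) set \<Rightarrow> (real ^ 'n \<Rightarrow> real) \<Rightarrow> (real ^ 'n \<Rightarrow> real ^ 'n) \<Rightarrow> bool" where
  "weak_gradient_on K v g \<longleftrightarrow>
     (\<forall>\<phi> i. test_function (interior K) \<phi> \<longrightarrow>
        (LINT x:K|lebesgue. v x * dir_deriv UNIV (axis i 1) \<phi> x) =
        - (LINT x:K|lebesgue. g x $ i * \<phi> x))"

definition H1_on :: "(real ^ 'n) set \<Rightarrow> (real ^ 'n \<Rightarrow> real) \<Rightarrow> bool" where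
  "H1_on K v \<longleftrightarrow>
     L2_on K v \<and> (\<exists>g. (\<forall>i. L2_on K (\<lambda>x. g x $ i)) \<and> weak_gradient_on K v g)"

text \<open>
  An elementwise field is a family \<open>G\<close> with \<open>G K\<close> the field on the closed simplex \<open>K\<close>;
  \<open>broken \<T> G\<close> is the corresponding field on the union of the mesh. On interfaces, which form a
  null set, the value from an arbitrary adjacent simplex is taken.
\<close>

definition broken ::
  "(real ^ 'n) set set \<Rightarrow> ((real ^ 'n) set \<Rightarrow> real ^ 'n \<Rightarrow> real ^ 'n) \<Rightarrow> real ^ 'n \<Rightarrow> real ^ 'n" where
  "broken \<T> G x = G (SOME K. K \<in> \<T> \<and> x \<in> K) x"


section \<open>Polynomial interpolation and best approximation\<close>

definition polys :: "nat \<Rightarrow> (real ^ 'n \<Rightarrow> real) set" where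
  "polys k = {q. \<exists>c. q = (\<lambda>x. \<Sum>\<alpha> | (\<Sum>i\<in>UNIV. \<alpha> i) \<le> k. c \<alpha> * (\<Prod>i\<in>UNIV. (x $ i) ^ \<alpha> i))}"

lemma finite_multi_indices: "finite {\<alpha> :: 'n::finite \<Rightarrow> nat. (\<Sum>i\<in>UNIV. \<alpha> i) \<le> k}"
proof (rule finite_subset)
  show "{\<alpha> :: 'n \<Rightarrow> nat. (\<Sum>i\<in>UNIV. \<alpha> i) \<le> k} \<subseteq> UNIV \<rightarrow>\<^sub>E {..k}"
    by (auto simp: PiE_def) (meson finite member_le_sum UNIV_I le_trans zero_le)
  show "finite (UNIV \<rightarrow>\<^sub>E {..k} :: ('n \<Rightarrow> nat) set)"
    by (intro finite_PiE) auto
qed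

definition num_points :: "nat \<Rightarrow> nat \<Rightarrow> nat" where
  "num_points d k = fact (k + d) div (fact k * fact d)"

definition unisolvent :: "nat \<Rightarrow> nat \<Rightarrow> (nat \<Rightarrow> real ^ 'n) \<Rightarrow> bool" where
  "unisolvent N k \<xi> \<longleftrightarrow> (\<forall>y. \<exists>!q. q \<in> polys k \<and> (\<forall>j\<in>{1..N}. q (\<xi> j) = y j))"

definition lagrange_basis ::
  "nat \<Rightarrow> nat \<Rightarrow> (nat \<Rightarrow> real ^ 'n) \<Rightarrow> (nat \<Rightarrow> real ^ 'n \<Rightarrow> real) \<Rightarrow> bool" where
  "lagrange_basis N k \<xi> L \<longleftrightarrow>
     (\<forall>j\<in>{1..N}. L j \<in> polys k \<and> (\<forall>m\<in>{1..N}. L j (\<xi> m) = (if j = m then 1 else 0)))"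

definition lebesgue_constant :: "(real ^ 'n) set \<Rightarrow> nat \<Rightarrow> (nat \<Rightarrow> real ^ 'n \<Rightarrow> real) \<Rightarrow> real" where
  "lebesgue_constant Kref N L = (SUP z\<in>Kref. \<Sum>m=1..N. \<bar>L m z\<bar>)"

definition affine_bijection ::
  "(real ^ 'n) set \<Rightarrow> (real ^ 'n) set \<Rightarrow> (real ^ 'n \<Rightarrow> real ^ 'n) \<Rightarrow> bool" where
  "affine_bijection K K' f \<longleftrightarrow> (\<exists>A b. linear A \<and> f = (\<lambda>x. A x + b)) \<and> bij_betw f K K'"

definition interpolant ::
  "nat \<Rightarrow> (nat \<Rightarrow> real ^ 'n) \<Rightarrow> (nat \<Rightarrow> real ^ 'n \<Rightarrow> real) \<Rightarrow> ((real ^ 'n) set \<Rightarrow> real ^ 'n \<Rightarrow> real ^ 'n) \<Rightarrow>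
   ((real ^ 'n) set \<Rightarrow> real ^ 'n \<Rightarrow> real ^ 'n) \<Rightarrow> (real ^ 'n) set \<Rightarrow> real ^ 'n \<Rightarrow> real ^ 'n" where
  "interpolant N \<xi> L \<psi> G K x =
     (\<chi> i. \<Sum>j=1..N. G K (inv_into K (\<psi> K) (\<xi> j)) $ i * L j (\<psi> K x))"

definition best_approx_on :: "nat \<Rightarrow> (real ^ 'n) set \<Rightarrow> (real ^ 'n \<Rightarrow> real) \<Rightarrow> (real ^ 'n \<Rightarrow> real) \<Rightarrow> bool" where
  "best_approx_on k K f q \<longleftrightarrow>
     q \<in> polys k \<and> (\<forall>r\<in>polys k. Linf_norm K (\<lambda>x. f x - q x) \<le> Linf_norm K (\<lambda>x. f x - r x))"


section \<open>The constants\<close>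

definition C1_const :: "(real ^ 'n) set set \<Rightarrow> ((real ^ 'n) set \<Rightarrow> nat \<Rightarrow> real ^ 'n) \<Rightarrow> real" where
  "C1_const \<T> p =
     sqrt ((real CARD('n) + 1) / (2 * real CARD('n))) *
     (MIN K\<in>\<T>. (MIN s\<in>{1..CARD('n) + 1}. infdist (p K s) (affine hull (opposite_facet p K s)))
                / diameter K)"

definition C3_const ::
  "(real ^ 'n) set \<Rightarrow> (real ^ 'n) set set \<Rightarrow> (real ^ 'n \<Rightarrow> real) \<Rightarrow> ((real ^ 'n) set \<Rightarrow> real) \<Rightarrow> real \<Rightarrow> real" where
  "C3_const \<Omega> \<T> D \<zeta> \<eta> =
     sqrt (min (1/2 * (MAX K\<in>\<T>. (min_containment_radius K)\<^sup>2) * C2_seminorm \<Omega> (\<lambda>x. 1 / (D x)\<^sup>2)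
                + Linf_norm \<Omega> (\<lambda>x. 1 / (D x)\<^sup>2) + (MAX K\<in>\<T>. \<bar>\<zeta> K\<bar>))
               (1 / \<eta>\<^sup>2))"

definition Theta :: "(real ^ 'n) set set \<Rightarrow> ((real ^ 'n) set \<Rightarrow> nat \<Rightarrow> real ^ 'n) \<Rightarrow> real" where
  "Theta \<T> p =
     (\<Sum>K\<in>\<T>. \<Sum>i=1..CARD('n) + 1. \<Sum>j=1..i - 1.
        ((p K j - p K i) \<bullet> (p K j - p K i)) * measure lebesgue K)"

end

theory Submission
  imports Defs
begin

text \<open>
  The estimate combines a pointwise bound for the interpolation error with a bound for the volume
  of the polytope.

  Pointwise, this is Lebesgue's lemma. On an element \<open>K\<close> let \<open>M\<close> bound the length of
  \<open>\<nabla>v - (\<nabla>v)\<^sup>*\<close>. Interpolation is linear and reproduces the polynomial field \<open>(\<nabla>v)\<^sup>*\<close>, so the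
  error of \<open>\<nabla>v\<close> is the error of \<open>\<nabla>v - (\<nabla>v)\<^sup>*\<close>, whose interpolant is a combination of vectors of
  length at most \<open>M\<close> with weights summing in absolute value to at most \<open>\<Lambda>\<close>. Hence the error
  is at most \<open>(1 + \<Lambda>) M\<close> everywhere on \<open>K\<close> (lemma \<open>norm_interpolation_error_le\<close>). One may take for
  \<open>M\<close> the essential supremum over the whole polytope: both fields are continuous on each closed
  element, and the element interiors cover the polytope up to a null set (lemma
  \<open>norm_le_Linf_norm_of_broken\<close>). Integration then gives the bound \<open>(1 + \<Lambda>) M\<close> times the square
  root of the total volume.

  It remains to see that this root is at most \<open>C\<^sub>3 \<surd>\<Theta> / C\<^sub>1\<close>. For every element, \<open>C\<^sub>3 \<ge> 1 / \<Delta>(K)\<close>,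
  by the vertex spacing and by the choice of \<open>\<zeta>\<^sub>K\<close> (lemma \<open>inverse_diameter_le_C3_const\<close>), while the
  sum of the squared edges is at least the largest one, \<open>\<Delta>(K)\<^sup>2\<close> (lemma
  \<open>diameter_le_sum_edges\<close>). So the product of \<open>C\<^sub>3\<^sup>2\<close> with the sum of the squared edges is at least
  \<open>1\<close>, and summing over the elements with the weights \<open>\<bar>K\<bar>\<close> gives that the volume is at most
  \<open>C\<^sub>3\<^sup>2 \<Theta>\<close>. Finally \<open>0 < C\<^sub>1 \<le> 1\<close>, because a height of a simplex never exceeds its diameter
  (lemma \<open>C1_const_bounds\<close>).
\<close>

section \<open>Polynomials of bounded total degree\<close>

lemma polysI:
  "(\<lambda>x. \<Sum>\<alpha> | (\<Sum>i\<in>UNIV. \<alpha> i) \<le> k. c \<alpha> * (\<Prod>i\<in>UNIV. (x $ i) ^ \<alpha> i)) \<in> polys k"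
  unfolding polys_def by (rule CollectI) (rule exI, rule refl)

lemma polysE:
  assumes "q \<in> polys k"
  obtains c where
    "q = (\<lambda>x. \<Sum>\<alpha> | (\<Sum>i\<in>UNIV. \<alpha> i) \<le> k. c \<alpha> * (\<Prod>i\<in>UNIV. (x $ i) ^ \<alpha> i))"
  using assms unfolding polys_def mem_Collect_eq by (elim exE)

lemma polys_scale: "f \<in> polys k \<Longrightarrow> (\<lambda>x. a * f x) \<in> polys k"
proof -
  assume "f \<in> polys k"
  then obtain c where "f = (\<lambda>x. \<Sum>\<alpha> | (\<Sum>i\<in>UNIV. \<alpha> i) \<le> k. c \<alpha> * (\<Prod>i\<in>UNIV. (x $ i) ^ \<alpha> i))"
    by (rule polysE)
  then have "(\<lambda>x. a * f x) =
      (\<lambda>x. \<Sum>\<alpha> | (\<Sum>i\<in>UNIV. \<alpha> i) \<le> k. (a * c \<alpha>) * (\<Prod>i\<in>UNIV. (x $ i) ^ \<alpha> i))"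
    by (simp only: sum_distrib_left mult.assoc)
  then show ?thesis by (simp only:) (rule polysI)
qed

lemma polys_add:
  assumes "f \<in> polys k" "g \<in> polys k"
  shows "(\<lambda>x. f x + g x) \<in> polys k"
proof -
  obtain c where f: "f = (\<lambda>x. \<Sum>\<alpha> | (\<Sum>i\<in>UNIV. \<alpha> i) \<le> k. c \<alpha> * (\<Prod>i\<in>UNIV. (x $ i) ^ \<alpha> i))"
    using assms(1) by (rule polysE)
  obtain d where g: "g = (\<lambda>x. \<Sum>\<alpha> | (\<Sum>i\<in>UNIV. \<alpha> i) \<le> k. d \<alpha> * (\<Prod>i\<in>UNIV. (x $ i) ^ \<alpha> i))"
    using assms(2) by (rule polysE)
  have "(\<lambda>x. f x + g x) =
      (\<lambda>x. \<Sum>\<alpha> | (\<Sum>i\<in>UNIV. \<alpha> i) \<le> k. (c \<alpha> + d \<alpha>) * (\<Prod>i\<in>UNIV. (x $ i) ^ \<alpha> i))"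
    by (simp only: f g sum.distrib distrib_right)
  then show ?thesis by (simp only:) (rule polysI)
qed

lemma polys_monomial:
  fixes \<beta> :: "'n::finite \<Rightarrow> nat"
  assumes "(\<Sum>i\<in>UNIV. \<beta> i) \<le> k"
  shows "(\<lambda>x. \<Prod>i\<in>UNIV. (x $ i) ^ \<beta> i) \<in> polys k"
proof -
  have eq: "(\<Sum>\<alpha> | (\<Sum>i\<in>UNIV. \<alpha> i) \<le> k.
      (if \<alpha> = \<beta> then 1 else 0) * (\<Prod>i\<in>UNIV. (x $ i) ^ \<alpha> i)) = (\<Prod>i\<in>UNIV. (x $ i) ^ \<beta> i)"
    (is "?l = ?r") for x :: "real ^ 'n"
  proof -
    have "?l = (\<Sum>\<alpha> | (\<Sum>i\<in>UNIV. \<alpha> i) \<le> k.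
        if \<alpha> = \<beta> then \<Prod>i\<in>UNIV. (x $ i) ^ \<alpha> i else 0)"
      by (intro sum.cong) auto
    also have "\<dots> = ?r"
      using assms by (simp add: finite_multi_indices)
    finally show ?thesis .
  qed
  show ?thesis unfolding eq[symmetric] by (rule polysI)
qed

lemma polys_const: "(\<lambda>x. a) \<in> polys k"
  using polys_scale[OF polys_monomial[of "\<lambda>_. 0" k], of a] by simp

lemma polys_sumI:
  assumes "finite I" "\<And>i. i \<in> I \<Longrightarrow> f i \<in> polys k"
  shows "(\<lambda>x. \<Sum>i\<in>I. f i x) \<in> polys k"
  using assms by (induction I) (auto simp: polys_const intro!: polys_add)

lemma polys_coordinate: "(\<lambda>x :: real ^ 'n. x $ i) \<in> polys (Suc 0)"
proof -
  have "(\<Prod>j\<in>UNIV. (x $ j) ^ (if j = i then 1 else 0)) =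
      (\<Prod>j\<in>UNIV. if j = i then x $ j else 1)" for x :: "real ^ 'n"
    by (intro prod.cong) auto
  then have "(\<Prod>j\<in>UNIV. (x $ j) ^ (if j = i then 1 else 0)) = x $ i" for x :: "real ^ 'n"
    by simp
  then show ?thesis using polys_monomial[of "\<lambda>j. if j = i then 1 else 0" "Suc 0"] by simp
qed

lemma polys_mult:
  assumes "f \<in> polys k" "g \<in> polys l"
  shows "(\<lambda>x. f x * g x) \<in> polys (k + l)"
proof -
  let ?M = "\<lambda>k. {\<alpha> :: 'a \<Rightarrow> nat. (\<Sum>i\<in>UNIV. \<alpha> i) \<le> k}"
  obtain c where f: "f = (\<lambda>x. \<Sum>\<alpha>\<in>?M k. c \<alpha> * (\<Prod>i\<in>UNIV. (x $ i) ^ \<alpha> i))"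
    using assms(1) by (rule polysE)
  obtain d where g: "g = (\<lambda>x. \<Sum>\<beta>\<in>?M l. d \<beta> * (\<Prod>i\<in>UNIV. (x $ i) ^ \<beta> i))"
    using assms(2) by (rule polysE)
  have "(\<lambda>x. f x * g x) = (\<lambda>x. \<Sum>\<alpha>\<in>?M k. \<Sum>\<beta>\<in>?M l.
      (c \<alpha> * d \<beta>) * (\<Prod>i\<in>UNIV. (x $ i) ^ (\<alpha> i + \<beta> i)))"
    by (simp add: f g sum_product power_add prod.distrib mult_ac)
  also have "\<dots> \<in> polys (k + l)"
    by (intro polys_sumI polys_scale polys_monomial finite_multi_indices) (simp add: sum.distrib add_mono)
  finally show ?thesis .
qed

lemma polys_power:
  assumes "f \<in> polys k" shows "(\<lambda>x. f x ^ n) \<in> polys (n * k)"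
proof (induction n)
  case 0
  show ?case by (simp add: polys_const)
next
  case (Suc n)
  show ?case using polys_mult[OF assms Suc] by simp
qed

lemma polys_prod:
  assumes "finite I" "\<And>i. i \<in> I \<Longrightarrow> f i \<in> polys (n i)"
  shows "(\<lambda>x. \<Prod>i\<in>I. f i x) \<in> polys (\<Sum>i\<in>I. n i)"
  using assms by (induction I) (auto simp: polys_const intro!: polys_mult)

lemma polys_mono:
  assumes "f \<in> polys k" "k \<le> l" shows "f \<in> polys l"
  using polys_mult[OF assms(1) polys_const[of 1 "l - k"]] assms(2) by simp

text \<open>
  Interpolation lives on the reference simplex and best approximation on the mesh elements, so
  degrees must survive the change of variables between them: each coordinate of an affine map
  has degree at most one, hence substituting it keeps the total degree of every monomial.
\<close>

lemma polys_compose_affine: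
  fixes A :: "real ^ 'n \<Rightarrow> real ^ 'm"
  assumes A: "linear A" and q: "q \<in> polys k"
  shows "(\<lambda>z. q (A z + b)) \<in> polys k"
proof -
  obtain c where c: "q = (\<lambda>x. \<Sum>\<alpha> | (\<Sum>i\<in>UNIV. \<alpha> i) \<le> k. c \<alpha> * (\<Prod>i\<in>UNIV. (x $ i) ^ \<alpha> i))"
    using q by (rule polysE)
  have "(\<lambda>z. (A z + b) $ i) = (\<lambda>z. (\<Sum>j\<in>UNIV. A (axis j 1) $ i * z $ j) + b $ i)" for i
  proof
    fix z
    have "A z = matrix A *v z" using A by simp
    then show "(A z + b) $ i = (\<Sum>j\<in>UNIV. A (axis j 1) $ i * z $ j) + b $ i"
      by (simp add: matrix_def matrix_vector_mult_def)
  qed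
  then have coord: "(\<lambda>z. (A z + b) $ i) \<in> polys (Suc 0)" for i
    by (simp add: polys_add polys_sumI polys_scale polys_coordinate polys_const)
  have "(\<lambda>z. \<Prod>i\<in>UNIV. ((A z + b) $ i) ^ \<alpha> i) \<in> polys k" if "(\<Sum>i\<in>UNIV. \<alpha> i) \<le> k" for \<alpha>
    using polys_mono[OF polys_prod[of UNIV "\<lambda>i z. ((A z + b) $ i) ^ \<alpha> i" "\<lambda>i. \<alpha> i * Suc 0"] ] that
      polys_power[OF coord] by simp
  then show ?thesis unfolding c
    by (intro polys_sumI polys_scale finite_multi_indices) simp
qed

section \<open>Stability of Lagrange interpolation\<close>

lemma continuous_on_polys:
  assumes "q \<in> polys k" shows "continuous_on A q"
  using assms unfolding polys_def by (auto intro!: continuous_intros)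

text \<open>
  Both sides are polynomials of degree at most \<open>k\<close> in \<open>z\<close> with the same values at the points
  \<open>\<xi> j\<close>, so unisolvence forces them to coincide.
\<close>

lemma lagrange_interpolation_eq:
  assumes "unisolvent N k \<xi>" "lagrange_basis N k \<xi> L" "q \<in> polys k"
  shows "(\<Sum>j=1..N. q (\<xi> j) * L j z) = q z"
proof -
  let ?r = "\<lambda>z. \<Sum>j=1..N. q (\<xi> j) * L j z"
  have "?r \<in> polys k"
    using assms(2) by (intro polys_sumI polys_scale) (auto simp: lagrange_basis_def)
  moreover have "\<forall>m\<in>{1..N}. ?r (\<xi> m) = q (\<xi> m)"
  proof
    fix m assume m: "m \<in> {1..N}"
    have "?r (\<xi> m) = (\<Sum>j=1..N. if j = m then q (\<xi> j) else 0)"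
      using assms(2) m by (intro sum.cong) (auto simp: lagrange_basis_def)
    then show "?r (\<xi> m) = q (\<xi> m)" using m by simp
  qed
  ultimately have "?r \<in> polys k \<and> (\<forall>m\<in>{1..N}. ?r (\<xi> m) = q (\<xi> m))" by blast
  moreover have "q \<in> polys k \<and> (\<forall>m\<in>{1..N}. q (\<xi> m) = q (\<xi> m))" using assms(3) by blast
  moreover obtain s where "\<And>t. t \<in> polys k \<and> (\<forall>m\<in>{1..N}. t (\<xi> m) = q (\<xi> m)) \<Longrightarrow> t = s"
  proof -
    have "\<exists>!r. r \<in> polys k \<and> (\<forall>m\<in>{1..N}. r (\<xi> m) = q (\<xi> m))"
      using assms(1) unfolding unisolvent_def by (rule spec)
    then show ?thesis using that by (elim ex1E) blast
  qed
  ultimately have "?r = s" "q = s" by blast+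
  then have "?r = q" by simp
  then show ?thesis by (rule fun_cong)
qed

text \<open>
  The hypothesis is a bijection between two sets only. An affine map that is injective on a set
  with interior points has an injective linear part, so that it is inverted by an affine map
  on the whole space; this is what makes pulling polynomials back and forth possible.
\<close>

lemma affine_bijection_inverse:
  fixes K K' :: "(real ^ 'n) set"
  assumes f: "affine_bijection K K' f" and int: "interior K \<noteq> {}"
  obtains A b where "linear A" "\<And>x. A (f x) + b = x"
proof -
  obtain B b where B: "linear B" and f_eq: "f = (\<lambda>x. B x + b)" and bij: "bij_betw f K K'"
    using f unfolding affine_bijection_def by blast
  have "inj B"
    unfolding linear_injective_0[OF B]
  proof (intro allI impI)
    fix u assume u: "B u = 0"
    obtain a where a: "a \<in> interior K" using int by blast
    then obtain e where e: "e > 0" "cball a e \<subseteq> K"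
      using mem_interior_cball by blast
    \<comment> \<open>A kernel vector, scaled to stay in the ball around \<open>a\<close>, would give a second point of \<open>K\<close>
      with the same image as \<open>a\<close>.\<close>
    show "u = 0"
    proof (rule ccontr)
      assume "u \<noteq> 0"
      let ?y = "a + (e / norm u) *\<^sub>R u"
      have "?y \<in> K" using e \<open>u \<noteq> 0\<close> by (auto simp: dist_norm intro!: subsetD[OF e(2)])
      moreover have "a \<in> K" using a interior_subset by blast
      moreover have "f ?y = f a" using u by (simp add: f_eq linear_add[OF B] linear_scale[OF B])
      ultimately have "?y = a" using bij by (meson bij_betw_def inj_onD)
      then show False using e \<open>u \<noteq> 0\<close> by simp
    qed
  qed
  then obtain C where C: "linear C" "C \<circ> B = id"
    using linear_injective_left_inverse[OF B] by blast
  have "C (f x) + - C b = x" for x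
    using C(2) by (simp add: f_eq linear_add[OF C(1)] fun_eq_iff)
  then show ?thesis using that C(1) by blast
qed

text \<open>
  Transporting \<open>Q K\<close> to the reference simplex by the inverse of \<open>\<psi> K\<close> leaves a polynomial of
  degree at most \<open>k\<close>, which Lagrange interpolation returns unchanged.
\<close>

lemma interpolant_reproduces_polys:
  assumes uni: "unisolvent N k \<xi>" and L: "lagrange_basis N k \<xi> L"
    and \<psi>: "affine_bijection K Kref (\<psi> K)" and int: "interior K \<noteq> {}"
    and \<xi>: "\<And>j. j \<in> {1..N} \<Longrightarrow> \<xi> j \<in> Kref"
    and q: "\<And>i. (\<lambda>x. Q K x $ i) \<in> polys k"
  shows "interpolant N \<xi> L \<psi> Q K x = Q K x"
proof -
  obtain A b where A: "linear A" and inv: "\<And>x. A (\<psi> K x) + b = x"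
    using affine_bijection_inverse[OF \<psi> int] by metis
  have node: "inv_into K (\<psi> K) (\<xi> j) = A (\<xi> j) + b" if "j \<in> {1..N}" for j
    using \<psi> \<xi>[OF that] inv unfolding affine_bijection_def bij_betw_def
    by (metis f_inv_into_f)
  show ?thesis
  proof (simp add: vec_eq_iff interpolant_def, intro allI)
    fix i
    have "(\<Sum>j=1..N. Q K (inv_into K (\<psi> K) (\<xi> j)) $ i * L j (\<psi> K x)) =
          (\<Sum>j=1..N. Q K (A (\<xi> j) + b) $ i * L j (\<psi> K x))"
      by (intro sum.cong) (auto simp: node)
    also have "\<dots> = Q K (A (\<psi> K x) + b) $ i"
      using lagrange_interpolation_eq[OF uni L polys_compose_affine[OF A q]] by simp
    finally show "(\<Sum>j = Suc 0..N. Q K (inv_into K (\<psi> K) (\<xi> j)) $ i * L j (\<psi> K x)) = Q K x $ i"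
      by (simp add: inv)
  qed
qed

text \<open>
  Compactness makes the supremum that defines the Lebesgue constant finite; for an unbounded
  set \<open>Sup\<close> would be an unspecified real.
\<close>

lemma lebesgue_constant_upper:
  assumes "compact Kref" "z \<in> Kref" "lagrange_basis N k \<xi> L"
  shows "(\<Sum>m=1..N. \<bar>L m z\<bar>) \<le> lebesgue_constant Kref N L"
  unfolding lebesgue_constant_def
proof (rule cSUP_upper[OF assms(2)])
  have "continuous_on Kref (L m)" if "m \<in> {1..N}" for m
    using assms(3) that continuous_on_polys unfolding lagrange_basis_def by blast
  then have "continuous_on Kref (\<lambda>z. \<Sum>m=1..N. \<bar>L m z\<bar>)"
    by (intro continuous_intros) auto
  then show "bdd_above ((\<lambda>z. \<Sum>m=1..N. \<bar>L m z\<bar>) ` Kref)"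
    using assms(1) by (intro bounded_imp_bdd_above compact_imp_bounded compact_continuous_image)
qed

text \<open>
  The interpolant at \<open>x\<close> is a linear combination of the nodal vectors of \<open>E K\<close> with the scalar
  weights \<open>L j (\<psi> K x)\<close>. Applying the triangle inequality to these vectors, and not to each
  component separately, gives the Lebesgue constant without a factor depending on the dimension.
\<close>

lemma norm_interpolant_le:
  assumes L: "lagrange_basis N k \<xi> L"
    and \<psi>: "affine_bijection K Kref (\<psi> K)" and "compact Kref"
    and \<xi>: "\<And>j. j \<in> {1..N} \<Longrightarrow> \<xi> j \<in> Kref"
    and M: "\<And>y. y \<in> K \<Longrightarrow> norm (E K y) \<le> M" and x: "x \<in> K"
  shows "norm (interpolant N \<xi> L \<psi> E K x) \<le> lebesgue_constant Kref N L * M"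
proof -
  have bij: "bij_betw (\<psi> K) K Kref" using \<psi> by (simp add: affine_bijection_def)
  have M0: "0 \<le> M" using M[OF x] norm_ge_zero order_trans by blast
  have node: "inv_into K (\<psi> K) (\<xi> j) \<in> K" if "j \<in> {1..N}" for j
    using bij \<xi>[OF that] by (simp add: bij_betw_def inv_into_into)
  have "interpolant N \<xi> L \<psi> E K x =
      (\<Sum>j=1..N. L j (\<psi> K x) *\<^sub>R E K (inv_into K (\<psi> K) (\<xi> j)))"
    by (simp add: vec_eq_iff interpolant_def mult.commute)
  also have "norm \<dots> \<le> (\<Sum>j=1..N. \<bar>L j (\<psi> K x)\<bar> * M)"
    by (intro sum_norm_le) (auto intro!: mult_left_mono M node)
  also have "\<dots> = (\<Sum>j=1..N. \<bar>L j (\<psi> K x)\<bar>) * M" by (simp add: sum_distrib_right)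
  also have "\<dots> \<le> lebesgue_constant Kref N L * M"
    using bij x \<open>compact Kref\<close> M0
    by (intro mult_right_mono lebesgue_constant_upper[OF _ _ L]) (auto simp: bij_betw_def)
  finally show ?thesis .
qed

text \<open>
  Lebesgue's lemma for vector fields: interpolation is linear and fixes \<open>Q K\<close>, so the
  error for \<open>G K\<close> equals the error for \<open>G K - Q K\<close>, a field of size at most \<open>M\<close>.
\<close>

lemma norm_interpolation_error_le:
  assumes uni: "unisolvent N k \<xi>" and L: "lagrange_basis N k \<xi> L"
    and \<psi>: "affine_bijection K Kref (\<psi> K)" and int: "interior K \<noteq> {}" and ref: "compact Kref"
    and \<xi>: "\<And>j. j \<in> {1..N} \<Longrightarrow> \<xi> j \<in> Kref"
    and q: "\<And>i. (\<lambda>x. Q K x $ i) \<in> polys k"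
    and M: "\<And>y. y \<in> K \<Longrightarrow> norm (G K y - Q K y) \<le> M" and x: "x \<in> K"
  shows "norm (G K x - interpolant N \<xi> L \<psi> G K x) \<le> (1 + lebesgue_constant Kref N L) * M"
proof -
  let ?E = "\<lambda>K y. G K y - Q K y"
  have "interpolant N \<xi> L \<psi> ?E K x = interpolant N \<xi> L \<psi> G K x - interpolant N \<xi> L \<psi> Q K x"
    by (simp add: vec_eq_iff interpolant_def sum_subtractf left_diff_distrib)
  moreover have "interpolant N \<xi> L \<psi> Q K x = Q K x"
    using uni L \<psi> int \<xi> q by (rule interpolant_reproduces_polys)
  ultimately have "G K x - interpolant N \<xi> L \<psi> G K x = ?E K x - interpolant N \<xi> L \<psi> ?E K x"
    by simp
  also have "norm \<dots> \<le> M + lebesgue_constant Kref N L * M"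
    using M[OF x] norm_interpolant_le[where \<psi> = \<psi> and K = K and E = ?E, OF L \<psi> ref \<xi> M x]
    by (meson norm_triangle_le_diff add_mono)
  finally show ?thesis by (simp add: distrib_right)
qed

section \<open>Essential suprema of continuous functions\<close>

lemma esssup_norm_nonneg:
  assumes "A \<in> sets lebesgue" "\<not> negligible A"
  shows "0 \<le> esssup (lebesgue_on A) (\<lambda>x. ereal (norm (f x)))"
proof -
  have "emeasure (lebesgue_on A) (space (lebesgue_on A)) \<noteq> 0"
    using assms by (auto simp: emeasure_restrict_space negligible_iff_null_sets)
  then have "esssup (lebesgue_on A) (\<lambda>x. 0 :: ereal) = 0"
    by (rule esssup_const)
  moreover have "esssup (lebesgue_on A) (\<lambda>x. 0 :: ereal) \<le> esssup (lebesgue_on A) (\<lambda>x. ereal (norm (f x)))"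
    by (rule esssup_mono) auto
  ultimately show ?thesis by simp
qed

lemma Linf_norm_nonneg:
  assumes "A \<in> sets lebesgue" "\<not> negligible A"
  shows "0 \<le> Linf_norm A f"
  unfolding Linf_norm_def using esssup_norm_nonneg[OF assms] by (rule real_of_ereal_pos)

text \<open>
  For a continuous function the essential supremum bounds every value, because a null set
  cannot contain a nonempty open set: the good points are dense in \<open>U\<close>, and the bound passes to
  the closure. Since \<open>f\<close> is tied to \<open>u\<close> on the open piece \<open>U\<close> alone, a discontinuous \<open>u\<close> can be
  treated piece by piece, each time up to the boundary of the piece. Measurability and essential
  boundedness of \<open>u\<close> exclude the case of an infinite essential supremum, where
  \<^const>\<open>Linf_norm\<close> would be \<open>0\<close>.
\<close>

lemma norm_le_Linf_norm:
  fixes A :: "(real ^ 'n) set" and u f :: "real ^ 'n \<Rightarrow> 'b::real_normed_vector"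
  assumes A: "A \<in> sets lebesgue" and u: "u \<in> borel_measurable (lebesgue_on A)"
    and bnd: "AE x in lebesgue_on A. norm (u x) \<le> B"
    and U: "open U" "U \<subseteq> A" and f: "continuous_on (closure U) f"
    and eq: "\<And>x. x \<in> U \<Longrightarrow> u x = f x" and x: "x \<in> closure U"
  shows "norm (f x) \<le> Linf_norm A u"
proof -
  let ?u = "\<lambda>x. ereal (norm (u x))"
  let ?s = "esssup (lebesgue_on A) ?u"
  have meas: "?u \<in> borel_measurable (lebesgue_on A)" using u by measurable
  have "U \<noteq> {}" using x by auto
  have "\<not> negligible A"
    using negligible_subset[OF _ U(2)] open_not_negligible[OF U(1) \<open>U \<noteq> {}\<close>] by blast
  have "?s \<le> ereal B" using meas bnd by (intro esssup_I) auto
  moreover have "0 \<le> ?s" using A \<open>\<not> negligible A\<close> by (rule esssup_norm_nonneg)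
  ultimately have s: "?s = ereal (Linf_norm A u)"
    unfolding Linf_norm_def by (cases ?s) auto
  have "AE x in lebesgue_on A. ?u x \<le> ?s" by (rule esssup_AE)
  then have "AE x in lebesgue. x \<in> A \<longrightarrow> norm (u x) \<le> Linf_norm A u"
    using A by (simp add: AE_restrict_space_iff s)
  then obtain Z where Z: "\<And>x. x \<in> space lebesgue - Z \<Longrightarrow> x \<in> A \<longrightarrow> norm (u x) \<le> Linf_norm A u"
      "Z \<in> null_sets lebesgue"
    by (rule AE_E3) blast
  have "U \<subseteq> closure (U - Z)"
  proof
    fix y assume y: "y \<in> U"
    show "y \<in> closure (U - Z)"
      unfolding closure_approachable
    proof (intro allI impI)
      fix e :: real assume "e > 0"
      have "open (U \<inter> ball y e)" "U \<inter> ball y e \<noteq> {}" using U y \<open>e > 0\<close> by auto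
      then have "\<not> negligible (U \<inter> ball y e)" by (rule open_not_negligible)
      then have "\<not> U \<inter> ball y e \<subseteq> Z"
        using Z(2) negligible_subset by (auto simp: negligible_iff_null_sets[symmetric])
      then show "\<exists>z\<in>U - Z. dist z y < e" by (auto simp: dist_commute)
    qed
  qed
  then have "closure U \<subseteq> closure (U - Z)"
    by (simp add: closure_minimal)
  then have "closure (U - Z) = closure U"
    by (meson Diff_subset closure_mono subset_antisym)
  moreover have "norm (f z) \<le> Linf_norm A u" if "z \<in> U - Z" for z
    using that Z(1)[of z] U(2) eq[of z] by auto
  ultimately show ?thesis
    using continuous_on_closure_norm_le[of "U - Z" f "Linf_norm A u" x] f x by auto
qed

lemma abs_le_Linf_norm_of_continuous:
  fixes f :: "real ^ 'n \<Rightarrow> real"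
  assumes "compact A" "convex A" "interior A \<noteq> {}" "continuous_on A f" "x \<in> A"
  shows "\<bar>f x\<bar> \<le> Linf_norm A f"
proof -
  have cl: "closure (interior A) = A"
    using assms by (simp add: convex_closure_interior compact_imp_closed)
  obtain B where B: "\<And>x. x \<in> A \<Longrightarrow> norm (f x) \<le> B"
    using compact_imp_bounded[OF compact_continuous_image[OF assms(4,1)]]
    by (auto simp: bounded_iff)
  have A: "A \<in> sets lebesgue" using assms(1) by (simp add: lmeasurable_compact fmeasurableD)
  have "f \<in> borel_measurable (lebesgue_on A)"
    using A assms(4) by (rule continuous_imp_measurable_on_sets_lebesgue[rotated])
  moreover have "AE x in lebesgue_on A. norm (f x) \<le> B"
    using A B by (simp add: AE_restrict_space_iff)
  ultimately have "norm (f x) \<le> Linf_norm A f"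
    using norm_le_Linf_norm[of A f B "interior A" f x] A assms(4,5) cl interior_subset[of A]
    by auto
  then show ?thesis by simp
qed

section \<open>Elementwise fields on a mesh\<close>

lemma simplex_vertices:
  fixes K :: "(real ^ 'n) set"
  assumes "int CARD('n) simplex K"
  shows "\<not> affine_dependent (verts K)" "card (verts K) = CARD('n) + 1" "convex hull verts K = K"
    "interior K \<noteq> {}"
proof -
  obtain C where C: "\<not> affine_dependent C" "int (card C) = int CARD('n) + 1" "K = convex hull C"
    using assms unfolding simplex_def by blast
  have "verts K = C"
    unfolding verts_def C(3) using extreme_point_of_convex_hull_affine_independent[OF C(1)] by blast
  then show "\<not> affine_dependent (verts K)" "card (verts K) = CARD('n) + 1" "convex hull verts K = K"
    using C by auto
  show "interior K \<noteq> {}"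
    using interior_convex_hull_eq_empty[of C] C by simp
qed

lemma is_meshD:
  fixes S :: "(real ^ 'n) set"
  assumes "is_mesh S \<T>"
  shows "finite \<T>" "K \<in> \<T> \<Longrightarrow> int CARD('n) simplex K" "(\<Union>K\<in>\<T>. verts K) = S"
    "K \<in> \<T> \<Longrightarrow> K' \<in> \<T> \<Longrightarrow> K \<noteq> K' \<Longrightarrow> interior K \<inter> interior K' = {}"
    "(\<Sum>K\<in>\<T>. measure lebesgue K) = measure lebesgue (convex hull S)"
  using assms by (simp_all add: is_mesh_def)

lemma mesh_element:
  fixes S :: "(real ^ 'n) set"
  assumes mesh: "is_mesh S \<T>" and K: "K \<in> \<T>"
  shows "int CARD('n) simplex K" "verts K \<subseteq> S" "K \<subseteq> convex hull S"
    "closure (interior K) = K" "negligible (frontier K)"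
proof -
  show s: "int CARD('n) simplex K" using is_meshD(2)[OF mesh K] .
  show v: "verts K \<subseteq> S" using is_meshD(3)[OF mesh] K by blast
  show "K \<subseteq> convex hull S"
    using hull_mono[OF v, of convex] by (simp add: simplex_vertices(3)[OF s])
  show "closure (interior K) = K"
    using simplex_vertices(4)[OF s] convex_simplex[OF s] compact_imp_closed[OF compact_simplex[OF s]]
    by (simp add: convex_closure_interior)
  show "negligible (frontier K)"
    using convex_simplex[OF s] by (rule negligible_convex_frontier)
qed

text \<open>
  If an open set meets \<open>K'\<close>, which is the closure of its interior, then it meets this interior.
\<close>

lemma mesh_interior_Int_eq_empty:
  fixes S :: "(real ^ 'n) set"
  assumes mesh: "is_mesh S \<T>" and K: "K \<in> \<T>" "K' \<in> \<T>" "K \<noteq> K'"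
  shows "interior K \<inter> K' = {}"
proof -
  have "interior K \<inter> interior K' = {}" using is_meshD(4)[OF mesh K] .
  then show ?thesis
    using open_Int_closure_eq_empty[of "interior K" "interior K'"] mesh_element(4)[OF mesh K(2)]
    by simp
qed

text \<open>
  Distinct elements overlap only in their frontiers, which are null sets. Hence the measure of
  the union is the sum of the measures, which equals that of the polytope; what the
  elements leave uncovered is therefore a null set.
\<close>

lemma mesh_covers_almost_everywhere:
  fixes S :: "(real ^ 'n) set"
  assumes mesh: "is_mesh S \<T>" and fin: "finite S"
  shows "negligible (convex hull S - (\<Union>K\<in>\<T>. interior K))"
proof -
  note finT = is_meshD(1)[OF mesh] and vol = is_meshD(5)[OF mesh]
  have lm: "K \<in> lmeasurable" if "K \<in> \<T>" for K
    using mesh_element(1)[OF mesh that] by (intro lmeasurable_compact compact_simplex)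
  have "negligible (K \<inter> K')" if "K \<in> \<T>" "K' \<in> \<T>" "K \<noteq> K'" for K K'
  proof (rule negligible_subset[OF mesh_element(5)[OF mesh that(1)]])
    show "K \<inter> K' \<subseteq> frontier K"
      using mesh_interior_Int_eq_empty[OF mesh that] closure_subset by (auto simp: frontier_def)
  qed
  then have "measure lebesgue (\<Union>\<T>) = measure lebesgue (convex hull S)"
    using measure_negligible_finite_Union[OF finT lm] vol by (simp add: pairwise_def)
  moreover have "convex hull S \<in> lmeasurable"
    using fin by (intro lmeasurable_compact finite_imp_compact_convex_hull)
  moreover have "\<Union>\<T> \<in> lmeasurable" using finT lm by (intro fmeasurable.finite_Union) auto
  moreover have "\<Union>\<T> \<subseteq> convex hull S" using mesh_element(3)[OF mesh] by blast
  ultimately have "negligible (convex hull S - \<Union>\<T>)"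
    by (simp add: negligible_iff_measure measurable_measure_Diff fmeasurable.Diff fmeasurableD)
  then have neg: "negligible ((convex hull S - \<Union>\<T>) \<union> (\<Union>K\<in>\<T>. frontier K))"
    using finT mesh_element(5)[OF mesh] by (intro negligible_Un negligible_Union) auto
  show ?thesis
  proof (rule negligible_subset[OF neg], rule subsetI)
    fix x assume "x \<in> convex hull S - (\<Union>K\<in>\<T>. interior K)"
    then show "x \<in> (convex hull S - \<Union>\<T>) \<union> (\<Union>K\<in>\<T>. frontier K)"
      using closure_subset by (auto simp: frontier_def)
  qed
qed

lemma broken_eq_on_interior:
  fixes S :: "(real ^ 'n) set"
  assumes mesh: "is_mesh S \<T>" and K: "K \<in> \<T>" and x: "x \<in> interior K"
  shows "broken \<T> G x = G K x"
proof -
  have "(SOME K. K \<in> \<T> \<and> x \<in> K) = K"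
  proof (rule some_equality)
    show "K \<in> \<T> \<and> x \<in> K" using K x subsetD[OF interior_subset] by simp
  next
    fix K' assume "K' \<in> \<T> \<and> x \<in> K'"
    then have "x \<in> interior K \<inter> K'" "K' \<in> \<T>" using x by simp_all
    then show "K' = K" using mesh_interior_Int_eq_empty[OF mesh K, of K'] by force
  qed
  then show ?thesis by (simp add: broken_def)
qed

text \<open>
  The polytope splits into finitely many open element
  interiors, where \<open>u\<close> is continuous, and a null set, where the values of \<open>u\<close> are unknown but
  every subset is Lebesgue measurable. So \<open>u\<close> is measurable and bounded almost everywhere, and
  its essential supremum bounds each piece up to the frontier.
\<close>

lemma norm_le_Linf_norm_of_broken:
  fixes S :: "(real ^ 'n) set" and E :: "(real ^ 'n) set \<Rightarrow> real ^ 'n \<Rightarrow> real ^ 'n"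
  assumes mesh: "is_mesh S \<T>" and fin: "finite S"
    and E: "\<And>K. K \<in> \<T> \<Longrightarrow> continuous_on K (E K)"
    and u: "\<And>K x. K \<in> \<T> \<Longrightarrow> x \<in> interior K \<Longrightarrow> u x = E K x"
    and K: "K \<in> \<T>" and x: "x \<in> K"
  shows "norm (E K x) \<le> Linf_norm (convex hull S) u"
proof -
  let ?\<Omega> = "convex hull S" and ?Z = "convex hull S - (\<Union>K\<in>\<T>. interior K)"
  have simp: "\<And>K. K \<in> \<T> \<Longrightarrow> int CARD('n) simplex K" and sub: "\<And>K. K \<in> \<T> \<Longrightarrow> K \<subseteq> ?\<Omega>"
    using mesh_element(1,3)[OF mesh] by simp_all
  note finT = is_meshD(1)[OF mesh]
  have Z: "negligible ?Z" using mesh_covers_almost_everywhere[OF mesh fin] .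
  have \<Omega>: "?\<Omega> \<in> sets lebesgue"
    using fin by (intro fmeasurableD lmeasurable_compact finite_imp_compact_convex_hull)
  have meas: "u \<in> borel_measurable (lebesgue_on ?\<Omega>)"
  proof (rule measurable_piecewise_restrict)
    let ?C = "insert ?Z (interior ` \<T>)"
    show "countable ?C" using finT by (simp add: countable_finite)
    show "space (lebesgue_on ?\<Omega>) \<subseteq> \<Union>?C" by auto
    show "W \<inter> space (lebesgue_on ?\<Omega>) \<in> sets (lebesgue_on ?\<Omega>)" if "W \<in> ?C" for W
    proof -
      have "W \<in> sets lebesgue" using that Z by (auto intro: negligible_imp_sets)
      then show ?thesis using \<Omega> by (auto simp: sets_restrict_space)
    qed
    show "u \<in> borel_measurable (restrict_space (lebesgue_on ?\<Omega>) W)" if "W \<in> ?C" for W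
    proof -
      have *: "restrict_space (lebesgue_on ?\<Omega>) W = lebesgue_on W"
      proof -
        have "W \<subseteq> ?\<Omega>" using that sub interior_subset by fastforce
        then have "W \<in> sets lebesgue" "?\<Omega> \<inter> W = W"
          using that Z by (auto intro: negligible_imp_sets)
        then show ?thesis using \<Omega> by (simp add: restrict_restrict_space)
      qed
      from that consider "W = ?Z" | K where "K \<in> \<T>" "W = interior K" by auto
      then show ?thesis
      proof cases
        case 1
        have "A \<in> sets (lebesgue_on ?Z)" if "A \<subseteq> ?Z" for A
          using negligible_imp_sets[OF negligible_subset[OF Z that]] that
            negligible_imp_sets[OF Z] by (simp add: sets_restrict_space_iff)
        then show ?thesis unfolding * unfolding 1 by (intro measurableI) auto
      next
        case 2
        have "E K \<in> borel_measurable (lebesgue_on (interior K))"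
          using E[OF 2(1)] interior_subset
          by (intro continuous_imp_measurable_on_sets_lebesgue) (auto intro: continuous_on_subset)
        then show ?thesis unfolding * unfolding 2(2)
          by (subst measurable_cong[of _ u "E K"]) (auto simp: u[OF 2(1)])
      qed
    qed
  qed
  have "\<exists>B. \<forall>x\<in>K. norm (E K x) \<le> B" if "K \<in> \<T>" for K
    using compact_imp_bounded[OF compact_continuous_image[OF E compact_simplex[OF simp]]] that
    by (auto simp: bounded_iff)
  then obtain B where B: "\<And>K x. K \<in> \<T> \<Longrightarrow> x \<in> K \<Longrightarrow> norm (E K x) \<le> B K" by metis
  have le: "norm (u x) \<le> (\<Sum>K\<in>\<T>. \<bar>B K\<bar>)" if "x \<in> ?\<Omega> - ?Z" for x
  proof -
    obtain K where K: "K \<in> \<T>" "x \<in> interior K" using \<open>x \<in> ?\<Omega> - ?Z\<close> by auto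
    then have "norm (u x) \<le> B K" using u[OF K] B[OF K(1)] interior_subset by auto
    also have "\<dots> \<le> \<bar>B K\<bar>" by simp
    also have "\<dots> \<le> (\<Sum>K\<in>\<T>. \<bar>B K\<bar>)" using finT K(1) by (intro member_le_sum) auto
    finally show ?thesis .
  qed
  have "AE x in lebesgue. x \<notin> ?Z"
    using Z by (intro AE_not_in) (simp add: negligible_iff_null_sets)
  then have bnd: "AE x in lebesgue_on ?\<Omega>. norm (u x) \<le> (\<Sum>K\<in>\<T>. \<bar>B K\<bar>)"
    using \<Omega> le by (auto simp: AE_restrict_space_iff elim!: eventually_mono)
  show ?thesis
    using norm_le_Linf_norm[OF \<Omega> meas bnd, of "interior K" "E K" x]
      mesh_element(4)[OF mesh K] E[OF K] u[OF K] x
      interior_subset[of K] sub[OF K] by auto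
qed

text \<open>
  Frontiers of elements are null sets, so the bound on the interiors can be integrated. If
  \<open>g \<bullet> g\<close> is not integrable over an element, its integral is \<open>0\<close> by convention, and then the
  comparison with the nonnegative constant \<open>M\<^sup>2\<close> holds as well.
\<close>

lemma L2_norm_mesh_le:
  fixes S :: "(real ^ 'n) set"
  assumes mesh: "is_mesh S \<T>" and M: "0 \<le> M"
    and g: "\<And>K x. K \<in> \<T> \<Longrightarrow> x \<in> interior K \<Longrightarrow> norm (g x) \<le> M"
  shows "L2_norm_mesh \<T> g \<le> M * sqrt (\<Sum>K\<in>\<T>. measure lebesgue K)"
proof -
  have "(LINT x:K|lebesgue. g x \<bullet> g x) \<le> M\<^sup>2 * measure lebesgue K" if K: "K \<in> \<T>" for K
  proof -
    have lm: "K \<in> lmeasurable"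
      using mesh_element(1)[OF mesh K] by (intro lmeasurable_compact compact_simplex)
    have "AE x in lebesgue. x \<notin> frontier K"
      using mesh_element(5)[OF mesh K] by (intro AE_not_in) (simp add: negligible_iff_null_sets)
    then have ae: "AE x in lebesgue. indicator K x *\<^sub>R (g x \<bullet> g x) \<le> indicator K x *\<^sub>R M\<^sup>2"
    proof (rule eventually_mono)
      fix x assume x: "x \<notin> frontier K"
      show "indicator K x *\<^sub>R (g x \<bullet> g x) \<le> indicator K x *\<^sub>R M\<^sup>2"
      proof (cases "x \<in> K")
        case True
        then have "x \<in> interior K" using x closure_subset by (auto simp: frontier_def)
        then have "(norm (g x))\<^sup>2 \<le> M\<^sup>2" using g[OF K] by (intro power_mono) auto
        then show ?thesis using True by (simp add: power2_norm_eq_inner)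
      qed simp
    qed
    have "(LINT x:K|lebesgue. g x \<bullet> g x) \<le> (LINT x|lebesgue. indicator K x *\<^sub>R M\<^sup>2)"
      unfolding set_lebesgue_integral_def
      using lm by (intro integral_mono_AE' ae) (auto simp: fmeasurable_def)
    also have "\<dots> = M\<^sup>2 * measure lebesgue K" using lm by simp
    finally show ?thesis .
  qed
  then have "(\<Sum>K\<in>\<T>. LINT x:K|lebesgue. g x \<bullet> g x) \<le> M\<^sup>2 * (\<Sum>K\<in>\<T>. measure lebesgue K)"
    by (simp add: sum_distrib_left sum_mono)
  then have "L2_norm_mesh \<T> g \<le> sqrt (M\<^sup>2 * (\<Sum>K\<in>\<T>. measure lebesgue K))"
    unfolding L2_norm_mesh_def by (rule real_sqrt_le_mono)
  also have "\<dots> = M * sqrt (\<Sum>K\<in>\<T>. measure lebesgue K)"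
    using M by (simp add: real_sqrt_mult)
  finally show ?thesis .
qed

section \<open>Geometry of simplices and the mesh constants\<close>

lemma simplex_diameter_attained:
  fixes K :: "(real ^ 'n) set"
  assumes "int CARD('n) simplex K"
  obtains a b where "a \<in> verts K" "b \<in> verts K" "dist a b = diameter K"
proof -
  have comp: "compact K" using assms by (rule compact_simplex)
  moreover have "K \<noteq> {}" using simplex_vertices(4)[OF assms] interior_subset by blast
  ultimately obtain x y where xy: "x \<in> K" "y \<in> K" "dist x y = diameter K"
    using diameter_compact_attained by blast
  have fin: "finite (verts K)"
    using simplex_vertices(2)[OF assms] by (intro card_ge_0_finite) simp
  obtain a b where ab: "a \<in> verts K" "b \<in> verts K" "norm (x - y) \<le> norm (a - b)"
    using simplex_extremal_le_exists[OF fin, of x y] xy(1,2) simplex_vertices(3)[OF assms] by auto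
  have "a \<in> K" "b \<in> K"
    using ab hull_inc[of _ "verts K" convex] simplex_vertices(3)[OF assms] by auto
  then have "dist a b \<le> diameter K"
    using compact_imp_bounded[OF comp] by (intro diameter_bounded_bound)
  then have "dist a b = diameter K" using ab(3) xy(3) by (simp add: dist_norm)
  then show ?thesis using that ab by blast
qed

lemma net_spacing_le_diameter:
  fixes S :: "(real ^ 'n) set"
  assumes mesh: "is_mesh S \<T>" and net: "is_net S \<epsilon> \<eta>" and K: "K \<in> \<T>"
  shows "\<eta> \<le> diameter K"
proof -
  note s = mesh_element(1)[OF mesh K]
  have "\<not> card (verts K) \<le> Suc 0" using simplex_vertices(2)[OF s] by simp
  moreover have "finite (verts K)"
    using simplex_vertices(2)[OF s] by (intro card_ge_0_finite) simp
  ultimately obtain a b where ab: "a \<in> verts K" "b \<in> verts K" "a \<noteq> b"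
    by (auto simp: card_le_Suc0_iff_eq)
  then have "\<eta> \<le> dist a b"
    using net mesh_element(2)[OF mesh K] unfolding is_net_def by blast
  also have "\<dots> \<le> diameter K"
    using ab hull_inc[of _ "verts K" convex] simplex_vertices(3)[OF s]
    by (intro diameter_bounded_bound compact_imp_bounded compact_simplex[OF s]) auto
  finally show ?thesis .
qed

text \<open>
  The longest edge joins two distinct vertices; ordering their indices makes the edge one of the
  summands.
\<close>

lemma diameter_le_sum_edges:
  fixes K :: "(real ^ 'n) set"
  assumes s: "int CARD('n) simplex K" and p: "bij_betw (p K) {1..CARD('n) + 1} (verts K)"
    and pos: "0 < diameter K"
  shows "(diameter K)\<^sup>2 \<le> (\<Sum>i=1..CARD('n) + 1. \<Sum>j=1..i - 1. (p K j - p K i) \<bullet> (p K j - p K i))"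
proof -
  let ?f = "\<lambda>i j. (p K j - p K i) \<bullet> (p K j - p K i)"
  obtain a b where ab: "a \<in> verts K" "b \<in> verts K" "dist a b = diameter K"
    using simplex_diameter_attained[OF s] by blast
  obtain m n where mn: "m \<in> {1..CARD('n) + 1}" "n \<in> {1..CARD('n) + 1}" "a = p K m" "b = p K n"
    using ab p unfolding bij_betw_def by (metis imageE)
  define i j where "i = max m n" and "j = min m n"
  have "m \<noteq> n" using mn ab(3) pos by auto
  then have ij: "i \<in> {1..CARD('n) + 1}" "j \<in> {1..i - 1}" using mn by (auto simp: i_def j_def)
  have "dist (p K j) (p K i) = diameter K"
    using ab(3) mn by (auto simp: i_def j_def max_def min_def dist_commute)
  then have "(diameter K)\<^sup>2 = ?f i j" by (simp add: dist_norm flip: power2_norm_eq_inner)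
  also have "\<dots> \<le> (\<Sum>j=1..i - 1. ?f i j)" using ij(2) by (intro member_le_sum) auto
  also have "\<dots> \<le> (\<Sum>i=1..CARD('n) + 1. \<Sum>j=1..i - 1. ?f i j)"
    using ij(1) by (intro member_le_sum[of i _ "\<lambda>i. \<Sum>j=1..i - 1. ?f i j"] sum_nonneg) auto
  finally show ?thesis .
qed

text \<open>
  A height is positive because the vertices are affinely independent and affine hulls are closed.
  It is at most the length of any edge from \<open>p K s\<close>, since the other endpoint of such an edge lies
  in the opposite facet.
\<close>

lemma simplex_height_bounds:
  fixes K :: "(real ^ 'n) set"
  assumes simp: "int CARD('n) simplex K" and p: "bij_betw (p K) {1..CARD('n) + 1} (verts K)"
    and s: "s \<in> {1..CARD('n) + 1}"
  shows "0 < infdist (p K s) (affine hull (opposite_facet p K s))"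
    "infdist (p K s) (affine hull (opposite_facet p K s)) \<le> diameter K"
proof -
  let ?I = "{1..CARD('n) + 1}"
  have inj: "inj_on (p K) ?I" and im: "p K ` ?I = verts K" using p by (auto simp: bij_betw_def)
  have others: "p K ` (?I - {s}) = verts K - {p K s}"
    using inj_on_image_set_diff[OF inj, of ?I "{s}"] s im by simp
  then have hull: "affine hull (opposite_facet p K s) = affine hull (verts K - {p K s})"
    unfolding opposite_facet_def by (simp add: affine_hull_convex_hull)
  have ps: "p K s \<in> verts K" using s im by blast
  have "p K s \<notin> affine hull (verts K - {p K s})"
    using simplex_vertices(1)[OF simp] ps unfolding affine_dependent_def by blast
  have "\<not> verts K \<subseteq> {p K s}"
  proof
    assume "verts K \<subseteq> {p K s}"
    then have "card (verts K) \<le> card {p K s}" by (intro card_mono) auto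
    then show False using simplex_vertices(2)[OF simp] by simp
  qed
  then obtain a where a: "a \<in> verts K - {p K s}" by blast
  then have ah: "a \<in> affine hull (verts K - {p K s})" by (rule hull_inc)
  show "0 < infdist (p K s) (affine hull (opposite_facet p K s))"
    unfolding hull using ah \<open>p K s \<notin> _\<close>
    by (intro infdist_pos_not_in_closed) (auto simp del: affine_hull_eq_empty)
  have "infdist (p K s) (affine hull (opposite_facet p K s)) \<le> dist (p K s) a"
    unfolding hull using ah by (rule infdist_le)
  also have "\<dots> \<le> diameter K"
    using a ps hull_inc[of _ "verts K" convex] simplex_vertices(3)[OF simp]
    by (intro diameter_bounded_bound compact_imp_bounded compact_simplex[OF simp]) auto
  finally show "infdist (p K s) (affine hull (opposite_facet p K s)) \<le> diameter K" .
qed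

text \<open>
  Heights do not exceed diameters, and \<open>(d + 1) / (2 d) \<le> 1\<close> for every \<open>d \<ge> 1\<close>.
\<close>

lemma C1_const_bounds:
  fixes \<T> :: "(real ^ 'n) set set"
  assumes T: "finite \<T>" "\<T> \<noteq> {}"
    and simp: "\<And>K. K \<in> \<T> \<Longrightarrow> int CARD('n) simplex K"
    and p: "\<And>K. K \<in> \<T> \<Longrightarrow> bij_betw (p K) {1..CARD('n) + 1} (verts K)"
  shows "0 < C1_const \<T> p" "C1_const \<T> p \<le> 1"
proof -
  let ?h = "\<lambda>K. MIN s\<in>{1..CARD('n) + 1}. infdist (p K s) (affine hull (opposite_facet p K s))"
  let ?q = "MIN K\<in>\<T>. ?h K / diameter K"
  have h: "0 < ?h K" "?h K \<le> diameter K" if K: "K \<in> \<T>" for K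
  proof -
    note b = simplex_height_bounds[where p = p and K = K, OF simp[OF K] p[OF K]]
    show "0 < ?h K" using b(1) by (subst Min_gr_iff) auto
    have "?h K \<le> infdist (p K 1) (affine hull (opposite_facet p K 1))" by (intro Min_le) auto
    also have "\<dots> \<le> diameter K" by (rule b(2)) simp
    finally show "?h K \<le> diameter K" .
  qed
  have ratio: "0 < ?h K / diameter K" "?h K / diameter K \<le> 1" if "K \<in> \<T>" for K
  proof -
    have "0 < diameter K" using h[OF that] by (rule less_le_trans)
    then show "0 < ?h K / diameter K" "?h K / diameter K \<le> 1"
      using h[OF that] by (simp_all only: divide_pos_pos divide_le_eq_1_pos)
  qed
  have pos: "0 < ?q" using T ratio(1) by (subst Min_gr_iff) auto
  have le: "?q \<le> 1"
  proof -
    obtain K where K: "K \<in> \<T>" using T by blast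
    have "?q \<le> ?h K / diameter K" using T K by (intro Min_le) auto
    then show ?thesis using ratio(2)[OF K] by linarith
  qed
  have d: "1 \<le> real CARD('n)" using zero_less_card_finite[where 'a = 'n] by linarith
  then show "0 < C1_const \<T> p" unfolding C1_const_def using pos by simp
  have "sqrt ((real CARD('n) + 1) / (2 * real CARD('n))) \<le> 1" using d by (simp add: field_simps)
  then show "C1_const \<T> p \<le> 1"
    unfolding C1_const_def using le pos by (intro mult_le_one) auto
qed

text \<open>
  Both entries of the minimum that defines \<open>C\<^sub>3\<close> bound \<open>1 / \<Delta>(K)\<^sup>2\<close>. For \<open>1 / \<eta>\<^sup>2\<close> this is the
  spacing of the vertices. For the other one, the choice of \<open>\<zeta> K\<close> gives
  \<open>1 / \<Delta>(K)\<^sup>2 \<le> max 1 / D\<^sup>2 + \<bar>\<zeta> K\<bar>\<close>, where the vertex values of \<open>1 / D\<^sup>2\<close> are bounded by its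
  essential supremum, and the term with the second derivatives is nonnegative.
\<close>

lemma inverse_diameter_le_C3_const:
  fixes \<Omega> S :: "(real ^ 'n) set"
  defines "\<Omega> \<equiv> convex hull S"
  assumes fin: "finite S"
    and \<eta>: "\<eta> > 0" "is_net S \<epsilon> \<eta>"
    and mesh: "is_mesh S \<T>" and K: "K \<in> \<T>"
    and p: "bij_betw (p K) {1..CARD('n) + 1} (verts K)"
    and D: "continuous_on \<Omega> (\<lambda>x. 1 / (D x)\<^sup>2)"
    and \<zeta>: "1 / (diameter K)\<^sup>2 + \<zeta> K \<le> (MAX i\<in>{1..CARD('n) + 1}. 1 / (D (p K i))\<^sup>2)"
  shows "1 / diameter K \<le> C3_const \<Omega> \<T> D \<zeta> \<eta>"
proof -
  let ?g = "\<lambda>x. 1 / (D x)\<^sup>2"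
  note finT = is_meshD(1)[OF mesh]
  have \<Omega>: "compact \<Omega>" "convex \<Omega>"
    using fin by (auto simp: \<Omega>_def finite_imp_compact_convex_hull)
  have int: "interior \<Omega> \<noteq> {}"
    using simplex_vertices(4)[OF mesh_element(1)[OF mesh K]] interior_mono[OF mesh_element(3)[OF mesh K]]
    unfolding \<Omega>_def by auto
  have "0 < diameter K" using net_spacing_le_diameter[OF mesh \<eta>(2) K] \<eta>(1) by simp
  have spacing: "1 / (diameter K)\<^sup>2 \<le> 1 / \<eta>\<^sup>2"
    using net_spacing_le_diameter[OF mesh \<eta>(2) K] \<eta>(1) by (intro divide_left_mono power_mono) auto
  have "?g (p K i) \<le> Linf_norm \<Omega> ?g" if "i \<in> {1..CARD('n) + 1}" for i
  proof -
    have "p K i \<in> verts K" using p that by (auto simp: bij_betw_def)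
    then have "p K i \<in> \<Omega>" using mesh_element(2)[OF mesh K] hull_subset[of S convex] by (auto simp: \<Omega>_def)
    from abs_le_Linf_norm_of_continuous[OF \<Omega> int D this] show ?thesis by simp
  qed
  then have "(MAX i\<in>{1..CARD('n) + 1}. ?g (p K i)) \<le> Linf_norm \<Omega> ?g"
    by (subst Max_le_iff) auto
  moreover have "\<bar>\<zeta> K\<bar> \<le> (MAX K\<in>\<T>. \<bar>\<zeta> K\<bar>)" using finT K by (intro Max_ge) auto
  moreover have "0 \<le> (MAX K\<in>\<T>. (min_containment_radius K)\<^sup>2)"
    using finT K by (intro order_trans[OF _ Max_ge[of _ "(min_containment_radius K)\<^sup>2"]]) auto
  moreover have "0 \<le> C2_seminorm \<Omega> ?g"
    unfolding C2_seminorm_def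
  proof (rule Linf_norm_nonneg)
    show "\<Omega> \<in> sets lebesgue" using \<Omega>(1) by (intro fmeasurableD lmeasurable_compact)
    show "\<not> negligible \<Omega>"
      using negligible_subset[OF _ interior_subset] open_not_negligible[OF open_interior int] by blast
  qed
  ultimately have sizing: "1 / (diameter K)\<^sup>2 \<le>
      1/2 * (MAX K\<in>\<T>. (min_containment_radius K)\<^sup>2) * C2_seminorm \<Omega> ?g
      + Linf_norm \<Omega> ?g + (MAX K\<in>\<T>. \<bar>\<zeta> K\<bar>)"
    using \<zeta> mult_nonneg_nonneg[of "1/2 * (MAX K\<in>\<T>. (min_containment_radius K)\<^sup>2)" "C2_seminorm \<Omega> ?g"]
    by linarith
  have "1 / diameter K = sqrt (1 / (diameter K)\<^sup>2)"
    using \<open>0 < diameter K\<close> by (simp add: real_sqrt_divide)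
  also have "\<dots> \<le> C3_const \<Omega> \<T> D \<zeta> \<eta>"
    unfolding C3_const_def using spacing sizing by (intro real_sqrt_le_mono min.boundedI)
  finally show ?thesis .
qed

section \<open>The interpolation error of the gradient\<close>

theorem corollary14:
  fixes S \<Omega> Kref :: "(real ^ 'n) set"
    and \<T> :: "(real ^ 'n) set set"
    and p :: "(real ^ 'n) set \<Rightarrow> nat \<Rightarrow> real ^ 'n"
    and D :: "real ^ 'n \<Rightarrow> real"
    and \<zeta> :: "(real ^ 'n) set \<Rightarrow> real"
    and \<epsilon> \<eta> :: real
    and k :: nat
    and \<xi> :: "nat \<Rightarrow> real ^ 'n"
    and L :: "nat \<Rightarrow> real ^ 'n \<Rightarrow> real"
    and \<psi> :: "(real ^ 'n) set \<Rightarrow> real ^ 'n \<Rightarrow> real ^ 'n"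
    and v :: "real ^ 'n \<Rightarrow> real"
    and G Gstar :: "(real ^ 'n) set \<Rightarrow> real ^ 'n \<Rightarrow> real ^ 'n"
  defines "\<Omega> \<equiv> convex hull S"
    and "N \<equiv> num_points CARD('n) k"
  assumes "finite S" and "aff_dim \<Omega> = int CARD('n)"
    and "\<epsilon> > 0" and "\<eta> > 0" and "is_net S \<epsilon> \<eta>"
    and "is_mesh S \<T>"
    and "\<And>K. K \<in> \<T> \<Longrightarrow> bij_betw (p K) {1..CARD('n) + 1} (verts K)"
    and "\<And>x. x \<in> \<Omega> \<Longrightarrow> D x > 0" and "Ck_on 2 \<Omega> (\<lambda>x. 1 / (D x)\<^sup>2)"
    and "\<And>K. K \<in> \<T> \<Longrightarrow> (MIN i\<in>{1..CARD('n) + 1}. 1 / (D (p K i))\<^sup>2) \<le> 1 / (diameter K)\<^sup>2 + \<zeta> K"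
    and "\<And>K. K \<in> \<T> \<Longrightarrow> 1 / (diameter K)\<^sup>2 + \<zeta> K \<le> (MAX i\<in>{1..CARD('n) + 1}. 1 / (D (p K i))\<^sup>2)"
    and "int CARD('n) simplex Kref"
    and "\<And>j. j \<in> {1..N} \<Longrightarrow> \<xi> j \<in> Kref"
    and "unisolvent N k \<xi>" and "lagrange_basis N k \<xi> L"
    and "\<And>K. K \<in> \<T> \<Longrightarrow> affine_bijection K Kref (\<psi> K)"
    and "\<And>K. K \<in> \<T> \<Longrightarrow> H1_on K v"
    and "\<And>K. K \<in> \<T> \<Longrightarrow> weak_gradient_on K v (G K) \<and> continuous_on K (G K)"
    and "\<And>K i. K \<in> \<T> \<Longrightarrow> best_approx_on k K (\<lambda>x. G K x $ i) (\<lambda>x. Gstar K x $ i)"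
  shows "L2_norm_mesh \<T> (\<lambda>x. broken \<T> G x - broken \<T> (interpolant N \<xi> L \<psi> G) x)
       \<le> (1 + lebesgue_constant Kref N L) * C3_const \<Omega> \<T> D \<zeta> \<eta> * sqrt (Theta \<T> p) / C1_const \<T> p
         * Linf_norm \<Omega> (\<lambda>x. broken \<T> G x - broken \<T> Gstar x)"
proof -
  note fin = assms(3) and dim = assms(4) and \<eta> = assms(6) and net = assms(7)
    and mesh = assms(8) and p = assms(9)
  let ?\<Lambda> = "lebesgue_constant Kref N L" and ?C1 = "C1_const \<T> p" and ?C3 = "C3_const \<Omega> \<T> D \<zeta> \<eta>"
  let ?u = "\<lambda>x. broken \<T> G x - broken \<T> Gstar x"
  let ?e = "\<lambda>x. broken \<T> G x - broken \<T> (interpolant N \<xi> L \<psi> G) x"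
  let ?M = "Linf_norm \<Omega> ?u"
  note finT = is_meshD(1)[OF mesh] and simp = mesh_element(1)[OF mesh]
  have ne: "\<T> \<noteq> {}"
    using is_meshD(3)[OF mesh] dim by (auto simp: \<Omega>_def)
  have cont: "continuous_on \<Omega> (\<lambda>x. 1 / (D x)\<^sup>2)"
    using assms(11) by (auto simp: numeral_2_eq_2 continuous_on_eq_continuous_within
        intro: differentiable_imp_continuous_within)
  have Gcont: "continuous_on K (G K)" if "K \<in> \<T>" for K using assms(20)[OF that] by blast
  have poly: "(\<lambda>x. Gstar K x $ i) \<in> polys k" if "K \<in> \<T>" for K i
    using assms(21)[OF that] by (simp add: best_approx_on_def)
  have E: "continuous_on K (\<lambda>x. G K x - Gstar K x)" if K: "K \<in> \<T>" for K
  proof -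
    have "continuous_on K (\<lambda>x. \<chi> i. Gstar K x $ i)"
      by (intro continuous_on_vec_lambda continuous_on_polys[OF poly[OF K]])
    then show ?thesis using Gcont[OF K] by (intro continuous_on_diff) simp_all
  qed
  have M: "norm (G K x - Gstar K x) \<le> ?M" if "K \<in> \<T>" "x \<in> K" for K x
    unfolding \<Omega>_def
    by (rule norm_le_Linf_norm_of_broken[where E = "\<lambda>K x. G K x - Gstar K x", OF mesh fin E _ that])
      (simp_all add: broken_eq_on_interior[OF mesh])
  obtain K0 where K0: "K0 \<in> \<T>" using ne by blast
  obtain x0 where "x0 \<in> K0" using simplex_vertices(4)[OF simp[OF K0]] interior_subset by blast
  then have M0: "0 \<le> ?M" using M[OF K0] norm_ge_zero order_trans by blast
  have ref: "compact Kref" using assms(14) by (rule compact_simplex)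
  have \<Lambda>0: "0 \<le> ?\<Lambda>"
  proof -
    obtain z where z: "z \<in> Kref" using simplex_vertices(4)[OF assms(14)] interior_subset by blast
    have "0 \<le> (\<Sum>m=1..N. \<bar>L m z\<bar>)" by (intro sum_nonneg) auto
    then show ?thesis using lebesgue_constant_upper[OF ref z assms(17)] by linarith
  qed
  have err: "norm (?e x) \<le> (1 + ?\<Lambda>) * ?M" if K: "K \<in> \<T>" and x: "x \<in> interior K" for K x
  proof -
    have "norm (G K x - interpolant N \<xi> L \<psi> G K x) \<le> (1 + ?\<Lambda>) * ?M"
      using x interior_subset[of K]
      by (intro norm_interpolation_error_le[where Q = Gstar and G = G and K = K and \<psi> = \<psi>, OF assms(16,17) assms(18)[OF K]
            simplex_vertices(4)[OF simp[OF K]] ref assms(15) poly[OF K] M[OF K]]) auto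
    then show ?thesis by (simp add: broken_eq_on_interior[OF mesh K x])
  qed
  have vol: "sqrt (\<Sum>K\<in>\<T>. measure lebesgue K) \<le> ?C3 * sqrt (Theta \<T> p) / ?C1"
  proof -
    note C1 = C1_const_bounds[where p = p, OF finT ne simp p]
    have C3: "1 / diameter K \<le> ?C3" if K: "K \<in> \<T>" for K
      using inverse_diameter_le_C3_const[where p = p and K = K and D = D and \<zeta> = \<zeta>, OF fin \<eta> net mesh K p[OF K]
          cont[unfolded \<Omega>_def] assms(13)[OF K]] by (simp add: \<Omega>_def)
    have dpos: "0 < diameter K" if "K \<in> \<T>" for K
      using net_spacing_le_diameter[OF mesh net that] \<eta> by simp
    have C3pos: "0 < ?C3" using C3[OF K0] dpos[OF K0] by (meson less_le_trans zero_less_divide_1_iff)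
    have "measure lebesgue K \<le> ?C3\<^sup>2 *
        (\<Sum>i=1..CARD('n) + 1. \<Sum>j=1..i - 1. ((p K j - p K i) \<bullet> (p K j - p K i)) * measure lebesgue K)"
      if K: "K \<in> \<T>" for K
    proof -
      let ?s = "\<Sum>i=1..CARD('n) + 1. \<Sum>j=1..i - 1. (p K j - p K i) \<bullet> (p K j - p K i)"
      \<comment> \<open>The largest squared edge alone compensates the factor \<open>1 / \<Delta>(K)\<^sup>2\<close>.\<close>
      have "1 = (1 / diameter K)\<^sup>2 * (diameter K)\<^sup>2" using dpos[OF K] by (simp add: power_divide)
      also have "\<dots> \<le> ?C3\<^sup>2 * ?s"
        using C3[OF K] dpos[OF K] diameter_le_sum_edges[where p = p and K = K, OF simp[OF K] p[OF K] dpos[OF K]]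
        by (intro mult_mono power_mono) auto
      finally have "1 * measure lebesgue K \<le> ?C3\<^sup>2 * ?s * measure lebesgue K"
        by (intro mult_right_mono) auto
      then show ?thesis by (simp only: sum_distrib_right mult.assoc mult_1_left)
    qed
    then have "(\<Sum>K\<in>\<T>. measure lebesgue K) \<le> ?C3\<^sup>2 * Theta \<T> p"
      unfolding Theta_def sum_distrib_left[of _ _ \<T>] by (intro sum_mono)
    then have "sqrt (\<Sum>K\<in>\<T>. measure lebesgue K) \<le> sqrt (?C3\<^sup>2 * Theta \<T> p)"
      by (rule real_sqrt_le_mono)
    also have "\<dots> = ?C3 * sqrt (Theta \<T> p)" using C3pos by (simp add: real_sqrt_mult)
    finally have main: "sqrt (\<Sum>K\<in>\<T>. measure lebesgue K) \<le> ?C3 * sqrt (Theta \<T> p)" .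
    \<comment> \<open>Division by \<open>C\<^sub>1\<close> only enlarges the right-hand side, because \<open>0 < C\<^sub>1 \<le> 1\<close>.\<close>
    have "sqrt (\<Sum>K\<in>\<T>. measure lebesgue K) * ?C1 \<le> sqrt (\<Sum>K\<in>\<T>. measure lebesgue K) * 1"
      using C1 by (intro mult_left_mono real_sqrt_ge_zero sum_nonneg) auto
    then show ?thesis using main C1(1) by (simp add: pos_le_divide_eq)
  qed
  have "L2_norm_mesh \<T> ?e \<le> ((1 + ?\<Lambda>) * ?M) * sqrt (\<Sum>K\<in>\<T>. measure lebesgue K)"
    using M0 \<Lambda>0 by (intro L2_norm_mesh_le[OF mesh] err) auto
  also have "\<dots> \<le> ((1 + ?\<Lambda>) * ?M) * (?C3 * sqrt (Theta \<T> p) / ?C1)"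
    using M0 \<Lambda>0 vol by (intro mult_left_mono) auto
  finally show ?thesis by (simp add: mult_ac)
qed

end
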